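(* Let $\mathbf{PN}=(\mathbf{GSet},\sqcup)$ be the monoidal category of question–answer triples described in the context. Every $\mathbf{PN}$-enriched category $\mathbf{E}$ provides the data of a nategory $\mathbf{C}$, where $\mathbf{C}$ is obtained from $\mathbf{E}$ by reading off objects, norphism sets, hom-sets, incompatibility relations, identities, morphism composition $;$ and norphism compositions $\triangleright,\triangleleft$ from the hom-objects, identity-choosing morphisms and composition morphisms of $\mathbf{E}$ as specified in the context. Moreover, the nategory $\mathbf{C}$ so produced has the following additional properties. (Identities act neutrally) For all objects $X,Y$ and all norphisms $n\in \mathrm{Nom}(X;Y)$, $$\mathrm{id}_X\triangleright n = n,\qquad n\triangleleft \mathrm{id}_Y=n.$$ (Compatibility with composition) For all objects $X,Y,Z,U$: for all morphisms $f\colon X\to Y$, $g\colon Y\to Z$ and all $n\in\mathrm{Nom}(X;U)$, $$(f\,;g)\triangleright n = g\triangleright (f\triangleright n);$$ and for all morphisms $g\colon Y\to Z$, $h\colon Z\to U$ and all $n\in\mathrm{Nom}(X;U)$, $$n\triangleleft (g\,;h) = (n\triangleleft h)\triangleleft g.$$ (The actions commute) For all objects $X,Y,Z,U$, all morphisms $f\colon X\to Y$, $h\colon Z\to U$ and all $n\in \mathrm{Nom}(X;U)$, $$f\triangleright (n\triangleleft h) = (f\triangleright n)\triangleleft h .$$ These additional properties are not satisfied by all nategories: there exists a nategory in which they do not all hold. Consequently, not every nategory can be specified by the data of a $\mathbf{PN}$-enriched category in this way.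
   Context: Composition is written in diagrammatic order: $f\,;g$ means first $f$, then $g$. $\bot,\top$ denote the truth values, with $\bot\le\top$, and $\vee$ is disjunction. **Nategory.** A (locally small) nategory $\mathbf{C}$ is a locally small category together with, for each pair of objects $X,Y$: a set $\mathrm{Nom}(X;Y)$ of "norphisms" and a function (incompatibility relation) $i_{XY}\colon \mathrm{Nom}(X;Y)\times\mathrm{Hom}(X;Y)\to\{\bot,\top\}$; and, for all objects $X,Y,Z$, two norphism composition functions $$\triangleright\colon \mathrm{Hom}(X;Y)\times\mathrm{Nom}(X;Z)\to\mathrm{Nom}(Y;Z),\qquad \triangleleft\colon \mathrm{Nom}(X;Z)\times\mathrm{Hom}(Y;Z)\to\mathrm{Nom}(X;Y),$$ such that for all $n\in\mathrm{Nom}(X;Z)$, $f\in\mathrm{Hom}(X;Y)$, $g\in\mathrm{Hom}(Y;Z)$: $$i_{YZ}(f\triangleright n,g)\Rightarrow i_{XZ}(n,f\,;g),\qquad i_{XY}(n\triangleleft g,f)\Rightarrow i_{XZ}(n,f\,;g).$$ No other axioms are imposed on $\triangleright$ and $\triangleleft$. **The category $\mathbf{GSet}$.** Objects are triples $(Q,A,\kappa)$ with $Q,A$ sets and $\kappa\colon Q\times A\to\{\bot,\top\}$ a function (equivalently, a relation between $Q$ and $A$). A morphism $r\colon (Q_1,A_1,\kappa_1)\to(Q_2,A_2,\kappa_2)$ is a pair of functions $r=(r_\flat,r^\sharp)$, with $r_\flat\colon Q_2\to Q_1$ (backward map) and $r^\sharp\colon A_1\to A_2$ (forward map), such that for all $q_2\in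 Q_2$, $a_1\in A_1$: $\kappa_1(r_\flat(q_2),a_1)\Rightarrow\kappa_2(q_2,r^\sharp(a_1))$. Composition is $(r\,;s)_\flat=s_\flat\,;r_\flat$ and $(r\,;s)^\sharp=r^\sharp\,;s^\sharp$; identities are pairs of identity functions. **The monoidal product $\sqcup$ on $\mathbf{GSet}$.** On objects, $$(Q_1,A_1,\kappa_1)\sqcup(Q_2,A_2,\kappa_2)=(Q_1^{A_2}\times Q_2^{A_1},\ A_1\times A_2,\ \kappa_1\sqcup\kappa_2),$$ $$(\kappa_1\sqcup\kappa_2)\big((q_1,q_2),(a_1,a_2)\big)=\kappa_1(q_1(a_2),a_1)\vee\kappa_2(q_2(a_1),a_2).$$ On morphisms $r\colon(Q_1,A_1,\kappa_1)\to(Q_3,A_3,\kappa_3)$ and $s\colon(Q_2,A_2,\kappa_2)\to(Q_4,A_4,\kappa_4)$: $(r\sqcup s)^\sharp=r^\sharp\times s^\sharp$ and $(r\sqcup s)_\flat(q_3,q_4)=(s^\sharp\,;q_3\,;r_\flat,\ r^\sharp\,;q_4\,;s_\flat)$ for $(q_3,q_4)\in Q_3^{A_4}\times Q_4^{A_3}$. The monoidal unit is $(\{\bullet\},\{\bullet\},\kappa)$ with $\kappa(\bullet,\bullet)=\bot$. The associator and unitors are the canonical ones: on forward maps they are those of the Cartesian product of sets, and on backward maps they are the evident (currying/uncurrying and rearrangement) bijections. Explicitly, the associator $(P_1\sqcup P_2)\sqcup P_3\to P_1\sqcup(P_2\sqcup P_3)$, where $P_i=(Q_i,A_i,\kappa_i)$,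 has backward map sending $(\varphi,\psi)$, with $\varphi\in Q_1^{A_2\times A_3}$ and $\psi=(\psi_2,\psi_3)\in (Q_2^{A_3}\times Q_3^{A_2})^{A_1}$, to $\big(a_3\mapsto(a_2\mapsto\varphi(a_2,a_3),\ a_1\mapsto\psi_2(a_1)(a_3)),\ (a_1,a_2)\mapsto\psi_3(a_1)(a_2)\big)$. The left unitor has backward map $q\mapsto(!,\bullet\mapsto q)$ and the right unitor has backward map $q\mapsto(\bullet\mapsto q,!)$, where $!$ is the unique map to $\{\bullet\}$. With this structure $(\mathbf{GSet},\sqcup)$ is a monoidal category, denoted $\mathbf{PN}$. **Enriched category.** A $\mathbf{PN}$-enriched category $\mathbf{E}$ is as usual: a collection of objects, hom-objects $\alpha_{XY}\in\mathbf{PN}$, composition morphisms $\beta_{XYZ}\colon\alpha_{XY}\sqcup\alpha_{YZ}\to\alpha_{XZ}$ and identity-choosing morphisms $\gamma_X\colon 1_\sqcup\to\alpha_{XX}$ (with $1_\sqcup$ the monoidal unit), satisfying the standard associativity and unitality diagrams. **Data read off from $\mathbf{E}$.** Given a $\mathbf{PN}$-enriched category $\mathbf{E}$, put $\mathrm{Ob}_{\mathbf{C}}=\mathrm{Ob}_{\mathbf{E}}$. Write $\alpha_{XY}=(Q_{XY},A_{XY},\kappa_{XY})$ and set $\mathrm{Nom}(X;Y)=Q_{XY}$, $\mathrm{Hom}(X;Y)=A_{XY}$, $i_{XY}=\kappa_{XY}$. Set $\mathrm{id}_X=\gamma_X^\sharp(\bullet)$ and $f\,;g=\beta_{XYZ}^\sharp(f,g)$.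 The backward map $(\beta_{XYZ})_\flat\colon\mathrm{Nom}(X;Z)\to\mathrm{Nom}(X;Y)^{\mathrm{Hom}(Y;Z)}\times\mathrm{Nom}(Y;Z)^{\mathrm{Hom}(X;Y)}$ defines the norphism compositions by $(\beta_{XYZ})_\flat(n)=\big(g\mapsto n\triangleleft g,\ f\mapsto f\triangleright n\big)$. *)

theory Defs
  imports Main "HOL-Library.FuncSet"
begin

section \<open>Nategories\<close>

text \<open>
  Hom-sets and norphism sets are families of subsets of common types; different members of a
  family may overlap, so every operation takes the objects involved as explicit arguments.
  Values outside the relevant carriers are irrelevant.
\<close>

record ('o, 'a) category =
  Ob :: "'o set"
  Hom :: "'o \<Rightarrow> 'o \<Rightarrow> 'a set"
  ident :: "'o \<Rightarrow> 'a"
  seq :: "'o \<Rightarrow> 'o \<Rightarrow> 'o \<Rightarrow> 'a \<Rightarrow> 'a \<Rightarrow> 'a"  \<comment> \<open>diagrammatic order\<close>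

locale category =
  fixes C :: "('o, 'a, 'm) category_scheme"
  assumes ident_in: "X \<in> Ob C \<Longrightarrow> ident C X \<in> Hom C X X"
    and comp_in: "\<lbrakk>X \<in> Ob C; Y \<in> Ob C; Z \<in> Ob C; f \<in> Hom C X Y; g \<in> Hom C Y Z\<rbrakk>
      \<Longrightarrow> seq C X Y Z f g \<in> Hom C X Z"
    and ident_comp: "\<lbrakk>X \<in> Ob C; Y \<in> Ob C; f \<in> Hom C X Y\<rbrakk>
      \<Longrightarrow> seq C X X Y (ident C X) f = f"
    and comp_ident: "\<lbrakk>X \<in> Ob C; Y \<in> Ob C; f \<in> Hom C X Y\<rbrakk>
      \<Longrightarrow> seq C X Y Y f (ident C Y) = f"
    and comp_assoc: "\<lbrakk>X \<in> Ob C; Y \<in> Ob C; Z \<in> Ob C; U \<in> Ob C;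
        f \<in> Hom C X Y; g \<in> Hom C Y Z; h \<in> Hom C Z U\<rbrakk>
      \<Longrightarrow> seq C X Z U (seq C X Y Z f g) h = seq C X Y U f (seq C Y Z U g h)"

text \<open>
  For \<open>n\<close> in \<open>Nom C X Z\<close>, \<open>f\<close> in \<open>Hom C X Y\<close> and \<open>g\<close> in \<open>Hom C Y Z\<close>,
  \<open>lact C X Y Z f n\<close> is \<open>f \<triangleright> n\<close> and \<open>ract C X Y Z n g\<close> is \<open>n \<triangleleft> g\<close>.
\<close>

record ('o, 'a, 'q) nategory = "('o, 'a) category" +
  Nom :: "'o \<Rightarrow> 'o \<Rightarrow> 'q set"
  incompat :: "'o \<Rightarrow> 'o \<Rightarrow> 'q \<Rightarrow> 'a \<Rightarrow> bool"
  lact :: "'o \<Rightarrow> 'o \<Rightarrow> 'o \<Rightarrow> 'a \<Rightarrow> 'q \<Rightarrow> 'q"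
  ract :: "'o \<Rightarrow> 'o \<Rightarrow> 'o \<Rightarrow> 'q \<Rightarrow> 'a \<Rightarrow> 'q"

locale nategory = category C for C :: "('o, 'a, 'q, 'm) nategory_scheme" +
  assumes lact_in: "\<lbrakk>X \<in> Ob C; Y \<in> Ob C; Z \<in> Ob C; f \<in> Hom C X Y; n \<in> Nom C X Z\<rbrakk>
      \<Longrightarrow> lact C X Y Z f n \<in> Nom C Y Z"
    and ract_in: "\<lbrakk>X \<in> Ob C; Y \<in> Ob C; Z \<in> Ob C; n \<in> Nom C X Z; g \<in> Hom C Y Z\<rbrakk>
      \<Longrightarrow> ract C X Y Z n g \<in> Nom C X Y"
    and incompat_lact: "\<lbrakk>X \<in> Ob C; Y \<in> Ob C; Z \<in> Ob C;
        n \<in> Nom C X Z; f \<in> Hom C X Y; g \<in> Hom C Y Z; incompat C Y Z (lact C X Y Z f n) g\<rbrakk>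
      \<Longrightarrow> incompat C X Z n (seq C X Y Z f g)"
    and incompat_ract: "\<lbrakk>X \<in> Ob C; Y \<in> Ob C; Z \<in> Ob C;
        n \<in> Nom C X Z; f \<in> Hom C X Y; g \<in> Hom C Y Z; incompat C X Y (ract C X Y Z n g) f\<rbrakk>
      \<Longrightarrow> incompat C X Z n (seq C X Y Z f g)"

definition identities_neutral :: "('o, 'a, 'q) nategory \<Rightarrow> bool" where
  "identities_neutral C \<longleftrightarrow>
    (\<forall>X\<in>Ob C. \<forall>Y\<in>Ob C. \<forall>n\<in>Nom C X Y.
      lact C X X Y (ident C X) n = n \<and> ract C X Y Y n (ident C Y) = n)"

definition actions_respect_comp :: "('o, 'a, 'q) nategory \<Rightarrow> bool" where
  "actions_respect_comp C \<longleftrightarrow>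
    (\<forall>X\<in>Ob C. \<forall>Y\<in>Ob C. \<forall>Z\<in>Ob C. \<forall>U\<in>Ob C.
      (\<forall>f\<in>Hom C X Y. \<forall>g\<in>Hom C Y Z. \<forall>n\<in>Nom C X U.
        lact C X Z U (seq C X Y Z f g) n = lact C Y Z U g (lact C X Y U f n)) \<and>
      (\<forall>g\<in>Hom C Y Z. \<forall>h\<in>Hom C Z U. \<forall>n\<in>Nom C X U.
        ract C X Y U n (seq C Y Z U g h) = ract C X Y Z (ract C X Z U n h) g))"

definition actions_commute :: "('o, 'a, 'q) nategory \<Rightarrow> bool" where
  "actions_commute C \<longleftrightarrow>
    (\<forall>X\<in>Ob C. \<forall>Y\<in>Ob C. \<forall>Z\<in>Ob C. \<forall>U\<in>Ob C.
      \<forall>f\<in>Hom C X Y. \<forall>h\<in>Hom C Z U. \<forall>n\<in>Nom C X U.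
        lact C X Y Z f (ract C X Z U n h) = ract C Y Z U (lact C X Y U f n) h)"

text \<open>Equality of nategory data, disregarding values outside the carriers.\<close>

definition same_nategory :: "('o, 'a, 'q) nategory \<Rightarrow> ('o, 'a, 'q) nategory \<Rightarrow> bool" where
  "same_nategory C D \<longleftrightarrow>
    Ob C = Ob D \<and>
    (\<forall>X\<in>Ob C. ident C X = ident D X) \<and>
    (\<forall>X\<in>Ob C. \<forall>Y\<in>Ob C. Hom C X Y = Hom D X Y \<and> Nom C X Y = Nom D X Y \<and>
      (\<forall>n\<in>Nom C X Y. \<forall>f\<in>Hom C X Y. incompat C X Y n f \<longleftrightarrow> incompat D X Y n f)) \<and>
    (\<forall>X\<in>Ob C. \<forall>Y\<in>Ob C. \<forall>Z\<in>Ob C.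
      (\<forall>f\<in>Hom C X Y. \<forall>g\<in>Hom C Y Z. seq C X Y Z f g = seq D X Y Z f g) \<and>
      (\<forall>f\<in>Hom C X Y. \<forall>n\<in>Nom C X Z. lact C X Y Z f n = lact D X Y Z f n) \<and>
      (\<forall>n\<in>Nom C X Z. \<forall>g\<in>Hom C Y Z. ract C X Y Z n g = ract D X Y Z n g))"


section \<open>The category GSet\<close>

text \<open>
  The product on GSet changes the underlying types, so objects and morphisms are polymorphic
  records. All functions between carriers are extensional (elements of \<open>\<rightarrow>\<^sub>E\<close>), so that
  \<open>A \<rightarrow>\<^sub>E Q\<close> is the exponential set and HOL equality is equality of morphisms.
\<close>

record ('q, 'a) gset =
  Qs :: "'q set"
  As :: "'a set"
  \<kappa> :: "'q \<Rightarrow> 'a \<Rightarrow> bool"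

record ('q1, 'a1, 'q2, 'a2) gmor =
  bwd :: "'q2 \<Rightarrow> 'q1"
  fwd :: "'a1 \<Rightarrow> 'a2"

definition gset_hom ::
    "('q1, 'a1) gset \<Rightarrow> ('q2, 'a2) gset \<Rightarrow> ('q1, 'a1, 'q2, 'a2) gmor set" where
  "gset_hom P R = {r. bwd r \<in> Qs R \<rightarrow>\<^sub>E Qs P \<and> fwd r \<in> As P \<rightarrow>\<^sub>E As R \<and>
    (\<forall>q\<in>Qs R. \<forall>a\<in>As P. \<kappa> P (bwd r q) a \<longrightarrow> \<kappa> R q (fwd r a))}"

definition gid :: "('q, 'a) gset \<Rightarrow> ('q, 'a, 'q, 'a) gmor" where
  "gid P = \<lparr>bwd = (\<lambda>q\<in>Qs P. q), fwd = (\<lambda>a\<in>As P. a)\<rparr>"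

text \<open>\<open>gcomp P R r s\<close> is the diagrammatic composite of \<open>r\<close> with domain \<open>P\<close> and \<open>s\<close> with
  codomain \<open>R\<close>.\<close>

definition gcomp ::
    "('q1, 'a1) gset \<Rightarrow> ('q3, 'a3) gset \<Rightarrow> ('q1, 'a1, 'q2, 'a2) gmor \<Rightarrow>
      ('q2, 'a2, 'q3, 'a3) gmor \<Rightarrow> ('q1, 'a1, 'q3, 'a3) gmor" where
  "gcomp P R r s =
    \<lparr>bwd = compose (Qs R) (bwd r) (bwd s), fwd = compose (As P) (fwd s) (fwd r)\<rparr>"


section \<open>The monoidal structure PN\<close>

definition gtensor ::
    "('q1, 'a1) gset \<Rightarrow> ('q2, 'a2) gset \<Rightarrow> (('a2 \<Rightarrow> 'q1) \<times> ('a1 \<Rightarrow> 'q2), 'a1 \<times> 'a2) gset"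
    (infixl "\<squnion>" 65) where
  "P1 \<squnion> P2 =
    \<lparr>Qs = (As P2 \<rightarrow>\<^sub>E Qs P1) \<times> (As P1 \<rightarrow>\<^sub>E Qs P2),
     As = As P1 \<times> As P2,
     \<kappa> = (\<lambda>(q1, q2) (a1, a2). \<kappa> P1 (q1 a2) a1 \<or> \<kappa> P2 (q2 a1) a2)\<rparr>"

text \<open>The product of \<open>r\<close> from \<open>P1\<close> to \<open>P3\<close> and \<open>s\<close> from \<open>P2\<close> to \<open>P4\<close>.\<close>

definition gtensor_mor ::
    "('q1, 'a1) gset \<Rightarrow> ('q2, 'a2) gset \<Rightarrow> ('q3, 'a3) gset \<Rightarrow> ('q4, 'a4) gset \<Rightarrow>
      ('q1, 'a1, 'q3, 'a3) gmor \<Rightarrow> ('q2, 'a2, 'q4, 'a4) gmor \<Rightarrow>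
      (('a2 \<Rightarrow> 'q1) \<times> ('a1 \<Rightarrow> 'q2), 'a1 \<times> 'a2, ('a4 \<Rightarrow> 'q3) \<times> ('a3 \<Rightarrow> 'q4), 'a3 \<times> 'a4) gmor" where
  "gtensor_mor P1 P2 P3 P4 r s =
    \<lparr>bwd = (\<lambda>(q3, q4)\<in>Qs (P3 \<squnion> P4).
       (\<lambda>a2\<in>As P2. bwd r (q3 (fwd s a2)), \<lambda>a1\<in>As P1. bwd s (q4 (fwd r a1)))),
     fwd = (\<lambda>(a1, a2)\<in>As (P1 \<squnion> P2). (fwd r a1, fwd s a2))\<rparr>"

definition gunit :: "(unit, unit) gset" where
  "gunit = \<lparr>Qs = {()}, As = {()}, \<kappa> = (\<lambda>_ _. False)\<rparr>"

definition gassoc where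
  "gassoc P1 P2 P3 =
    \<lparr>bwd = (\<lambda>(\<phi>, \<psi>)\<in>Qs (P1 \<squnion> (P2 \<squnion> P3)).
       (\<lambda>a3\<in>As P3. (\<lambda>a2\<in>As P2. \<phi> (a2, a3), \<lambda>a1\<in>As P1. fst (\<psi> a1) a3),
        \<lambda>(a1, a2)\<in>As P1 \<times> As P2. snd (\<psi> a1) a2)),
     fwd = (\<lambda>((a1, a2), a3)\<in>As (P1 \<squnion> P2 \<squnion> P3). (a1, (a2, a3)))\<rparr>"

definition glunit where
  "glunit P =
    \<lparr>bwd = (\<lambda>q\<in>Qs P. (\<lambda>a\<in>As P. (), \<lambda>u\<in>{()}. q)),
     fwd = (\<lambda>(u, a)\<in>As (gunit \<squnion> P). a)\<rparr>"

definition grunit where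
  "grunit P =
    \<lparr>bwd = (\<lambda>q\<in>Qs P. (\<lambda>u\<in>{()}. q, \<lambda>a\<in>As P. ())),
     fwd = (\<lambda>(a, u)\<in>As (P \<squnion> gunit). a)\<rparr>"

lemma gid_in_hom: "gid P \<in> gset_hom P P"
  by (auto simp: gset_hom_def gid_def)

lemma gcomp_in_hom:
  "\<lbrakk>r \<in> gset_hom P R; s \<in> gset_hom R S\<rbrakk> \<Longrightarrow> gcomp P S r s \<in> gset_hom P S"
  by (fastforce simp: gset_hom_def gcomp_def compose_def PiE_iff)

lemma gtensor_mor_in_hom:
  "\<lbrakk>r \<in> gset_hom P1 P3; s \<in> gset_hom P2 P4\<rbrakk>
    \<Longrightarrow> gtensor_mor P1 P2 P3 P4 r s \<in> gset_hom (P1 \<squnion> P2) (P3 \<squnion> P4)"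
  by (fastforce simp: gset_hom_def gtensor_mor_def gtensor_def PiE_iff)

lemma gassoc_in_hom: "gassoc P1 P2 P3 \<in> gset_hom (P1 \<squnion> P2 \<squnion> P3) (P1 \<squnion> (P2 \<squnion> P3))"
  by (auto simp: gset_hom_def gassoc_def gtensor_def PiE_iff mem_Times_iff split: prod.splits)

lemma glunit_in_hom: "glunit P \<in> gset_hom (gunit \<squnion> P) P"
  by (auto simp: gset_hom_def glunit_def gtensor_def gunit_def)

lemma grunit_in_hom: "grunit P \<in> gset_hom (P \<squnion> gunit) P"
  by (auto simp: gset_hom_def grunit_def gtensor_def gunit_def)


section \<open>Categories enriched in PN\<close>

record ('o, 'a, 'q) PN_category =
  EOb :: "'o set"
  \<alpha> :: "'o \<Rightarrow> 'o \<Rightarrow> ('q, 'a) gset"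
  \<beta> :: "'o \<Rightarrow> 'o \<Rightarrow> 'o \<Rightarrow> (('a \<Rightarrow> 'q) \<times> ('a \<Rightarrow> 'q), 'a \<times> 'a, 'q, 'a) gmor"
  \<gamma> :: "'o \<Rightarrow> (unit, unit, 'q, 'a) gmor"

locale PN_category =
  fixes E :: "('o, 'a, 'q) PN_category"
  assumes comp_in_hom: "\<lbrakk>X \<in> EOb E; Y \<in> EOb E; Z \<in> EOb E\<rbrakk>
      \<Longrightarrow> \<beta> E X Y Z \<in> gset_hom (\<alpha> E X Y \<squnion> \<alpha> E Y Z) (\<alpha> E X Z)"
    and ident_in_hom: "X \<in> EOb E \<Longrightarrow> \<gamma> E X \<in> gset_hom gunit (\<alpha> E X X)"
    and assoc: "\<lbrakk>X \<in> EOb E; Y \<in> EOb E; Z \<in> EOb E; U \<in> EOb E\<rbrakk> \<Longrightarrow>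
      gcomp (\<alpha> E X Y \<squnion> \<alpha> E Y Z \<squnion> \<alpha> E Z U) (\<alpha> E X U)
        (gtensor_mor (\<alpha> E X Y \<squnion> \<alpha> E Y Z) (\<alpha> E Z U) (\<alpha> E X Z) (\<alpha> E Z U)
          (\<beta> E X Y Z) (gid (\<alpha> E Z U)))
        (\<beta> E X Z U) =
      gcomp (\<alpha> E X Y \<squnion> \<alpha> E Y Z \<squnion> \<alpha> E Z U) (\<alpha> E X U)
        (gassoc (\<alpha> E X Y) (\<alpha> E Y Z) (\<alpha> E Z U))
        (gcomp (\<alpha> E X Y \<squnion> (\<alpha> E Y Z \<squnion> \<alpha> E Z U)) (\<alpha> E X U)
          (gtensor_mor (\<alpha> E X Y) (\<alpha> E Y Z \<squnion> \<alpha> E Z U) (\<alpha> E X Y) (\<alpha> E Y U)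
            (gid (\<alpha> E X Y)) (\<beta> E Y Z U))
          (\<beta> E X Y U))"
    and left_unit: "\<lbrakk>X \<in> EOb E; Y \<in> EOb E\<rbrakk> \<Longrightarrow>
      gcomp (gunit \<squnion> \<alpha> E X Y) (\<alpha> E X Y)
        (gtensor_mor gunit (\<alpha> E X Y) (\<alpha> E X X) (\<alpha> E X Y) (\<gamma> E X) (gid (\<alpha> E X Y)))
        (\<beta> E X X Y) =
      glunit (\<alpha> E X Y)"
    and right_unit: "\<lbrakk>X \<in> EOb E; Y \<in> EOb E\<rbrakk> \<Longrightarrow>
      gcomp (\<alpha> E X Y \<squnion> gunit) (\<alpha> E X Y)
        (gtensor_mor (\<alpha> E X Y) gunit (\<alpha> E X Y) (\<alpha> E Y Y) (gid (\<alpha> E X Y)) (\<gamma> E Y))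
        (\<beta> E X Y Y) =
      grunit (\<alpha> E X Y)"

definition nategory_of :: "('o, 'a, 'q) PN_category \<Rightarrow> ('o, 'a, 'q) nategory" where
  "nategory_of E =
    \<lparr>Ob = EOb E,
     Hom = (\<lambda>X Y. As (\<alpha> E X Y)),
     ident = (\<lambda>X. fwd (\<gamma> E X) ()),
     seq = (\<lambda>X Y Z f g. fwd (\<beta> E X Y Z) (f, g)),
     Nom = (\<lambda>X Y. Qs (\<alpha> E X Y)),
     incompat = (\<lambda>X Y. \<kappa> (\<alpha> E X Y)),
     lact = (\<lambda>X Y Z f n. snd (bwd (\<beta> E X Y Z) n) f),
     ract = (\<lambda>X Y Z n g. fst (bwd (\<beta> E X Y Z) n) g)\<rparr>"

end

theory Submission
  imports Defs
begin

text \<open>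
  A morphism of GSet is a pair of functions, so each coherence diagram of an enriched category
  is a pair of equations between functions, one for the forward and one for the backward maps.
  On forward maps the product of GSet is the Cartesian product of sets, and the diagrams are the
  axioms of a category. On backward maps everything is obtained by evaluating at a norphism \<open>n\<close>.

  For the associativity square with objects \<open>X, Y, Z, U\<close>, the source of the backward map is
  \<open>Nom X U\<close> and its target, the question set of a threefold product, has three
  components: functions of \<open>(h, g)\<close>, of \<open>(h, f)\<close> and of \<open>(f, g)\<close>, where
  \<open>f : X \<rightarrow> Y\<close>, \<open>g : Y \<rightarrow> Z\<close> and \<open>h : Z \<rightarrow> U\<close>. A component thus fixes two of the three composable
  arrows and transports \<open>n\<close> to a norphism between the end points of the remaining one. Comparing the two sides
  of the square component by component gives
  \<open>(n \<triangleleft> h) \<triangleleft> g = n \<triangleleft> (g ; h)\<close>, \<open>f \<triangleright> (n \<triangleleft> h) = (f \<triangleright> n) \<triangleleft> h\<close> and \<open>(f ; g) \<triangleright> n = g \<triangleright> (f \<triangleright> n)\<close>: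
  the two compatibilities with composition, and between them the commutation of the actions.
  In the unit triangles one component of the backward map is a function into a singleton, and the
  other says that the identity acts neutrally. The two implications required of a
  nategory are the two disjuncts in the relation of the product, carried along the
  composition morphism.

  Conversely, the neutrality of identities is a property of the nategory data alone, so a
  nategory that violates it does not come from an enriched category. One arrow and two
  norphisms suffice: with the empty incompatibility relation the axioms do not constrain
  the actions, which may then be constant.
\<close>

section \<open>From enriched categories to nategories\<close>

lemma (in PN_category) comp_bwd_in:
  assumes "X \<in> EOb E" "Y \<in> EOb E" "Z \<in> EOb E" "n \<in> Qs (\<alpha> E X Z)"
  shows "fst (bwd (\<beta> E X Y Z) n) \<in> As (\<alpha> E Y Z) \<rightarrow>\<^sub>E Qs (\<alpha> E X Y)"
    and "snd (bwd (\<beta> E X Y Z) n) \<in> As (\<alpha> E X Y) \<rightarrow>\<^sub>E Qs (\<alpha> E Y Z)"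
proof -
  have "bwd (\<beta> E X Y Z) n \<in> Qs (\<alpha> E X Y \<squnion> \<alpha> E Y Z)"
    using comp_in_hom[OF assms(1-3)] assms(4) by (auto simp: gset_hom_def)
  then show "fst (bwd (\<beta> E X Y Z) n) \<in> As (\<alpha> E Y Z) \<rightarrow>\<^sub>E Qs (\<alpha> E X Y)"
    and "snd (bwd (\<beta> E X Y Z) n) \<in> As (\<alpha> E X Y) \<rightarrow>\<^sub>E Qs (\<alpha> E Y Z)"
    by (simp_all add: gtensor_def mem_Times_iff)
qed

lemma (in PN_category) comp_fwd_in:
  assumes "X \<in> EOb E" "Y \<in> EOb E" "Z \<in> EOb E" "f \<in> As (\<alpha> E X Y)" "g \<in> As (\<alpha> E Y Z)"
  shows "fwd (\<beta> E X Y Z) (f, g) \<in> As (\<alpha> E X Z)"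
proof -
  have "fwd (\<beta> E X Y Z) \<in> As (\<alpha> E X Y \<squnion> \<alpha> E Y Z) \<rightarrow>\<^sub>E As (\<alpha> E X Z)"
    using comp_in_hom[OF assms(1-3)] by (simp add: gset_hom_def)
  then show ?thesis
    using assms(4,5) by (auto simp: gtensor_def)
qed

lemma (in PN_category) ident_fwd_in:
  "X \<in> EOb E \<Longrightarrow> fwd (\<gamma> E X) () \<in> As (\<alpha> E X X)"
  using ident_in_hom[of X] by (auto simp: gset_hom_def gunit_def)

text \<open>The defining condition on \<open>\<beta> E X Y Z\<close> as a morphism of GSet. The left-hand side is
  the relation of a product, whose two disjuncts are the hypotheses of the two
  axioms on incompatibility.\<close>

lemma (in PN_category) comp_incompat:
  assumes "X \<in> EOb E" "Y \<in> EOb E" "Z \<in> EOb E"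
    and "n \<in> Qs (\<alpha> E X Z)" "f \<in> As (\<alpha> E X Y)" "g \<in> As (\<alpha> E Y Z)"
    and "\<kappa> (\<alpha> E X Y) (fst (bwd (\<beta> E X Y Z) n) g) f \<or> \<kappa> (\<alpha> E Y Z) (snd (bwd (\<beta> E X Y Z) n) f) g"
  shows "\<kappa> (\<alpha> E X Z) n (fwd (\<beta> E X Y Z) (f, g))"
proof -
  have "\<forall>a\<in>As (\<alpha> E X Y \<squnion> \<alpha> E Y Z). \<kappa> (\<alpha> E X Y \<squnion> \<alpha> E Y Z) (bwd (\<beta> E X Y Z) n) a
      \<longrightarrow> \<kappa> (\<alpha> E X Z) n (fwd (\<beta> E X Y Z) a)"
    using comp_in_hom[OF assms(1-3)] assms(4) by (simp add: gset_hom_def)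
  then show ?thesis
    using assms(5-7) by (auto simp: gtensor_def case_prod_beta)
qed

lemma (in PN_category) assoc_fwd:
  assumes "X \<in> EOb E" "Y \<in> EOb E" "Z \<in> EOb E" "U \<in> EOb E"
    and "f \<in> As (\<alpha> E X Y)" "g \<in> As (\<alpha> E Y Z)" "h \<in> As (\<alpha> E Z U)"
  shows "fwd (\<beta> E X Z U) (fwd (\<beta> E X Y Z) (f, g), h) = fwd (\<beta> E X Y U) (f, fwd (\<beta> E Y Z U) (g, h))"
  using arg_cong[OF assoc[OF assms(1-4)], of "\<lambda>r. fwd r ((f, g), h)"] assms(5-7)
  by (simp add: gcomp_def compose_def gtensor_mor_def gassoc_def gid_def gtensor_def)

text \<open>The backward half of the associativity square at \<open>n\<close>, as an equation in the
  question set of \<open>\<alpha> E X Y \<squnion> \<alpha> E Y Z \<squnion> \<alpha> E Z U\<close>. The three laws of the actions are its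
  components.\<close>

lemma (in PN_category) assoc_bwd:
  assumes "X \<in> EOb E" "Y \<in> EOb E" "Z \<in> EOb E" "U \<in> EOb E" and n: "n \<in> Qs (\<alpha> E X U)"
  shows "(\<lambda>h\<in>As (\<alpha> E Z U). bwd (\<beta> E X Y Z) (fst (bwd (\<beta> E X Z U) n) h),
      \<lambda>p\<in>As (\<alpha> E X Y) \<times> As (\<alpha> E Y Z). snd (bwd (\<beta> E X Z U) n) (fwd (\<beta> E X Y Z) p)) =
    (\<lambda>h\<in>As (\<alpha> E Z U).
        (\<lambda>g\<in>As (\<alpha> E Y Z). fst (bwd (\<beta> E X Y U) n) (fwd (\<beta> E Y Z U) (g, h)),
         \<lambda>f\<in>As (\<alpha> E X Y). fst (bwd (\<beta> E Y Z U) (snd (bwd (\<beta> E X Y U) n) f)) h),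
      \<lambda>(f, g)\<in>As (\<alpha> E X Y) \<times> As (\<alpha> E Y Z).
        snd (bwd (\<beta> E Y Z U) (snd (bwd (\<beta> E X Y U) n) f)) g)"
    (is "?L = ?R")
proof -
  let ?XY = "\<alpha> E X Y" and ?YZ = "\<alpha> E Y Z" and ?ZU = "\<alpha> E Z U"
  note in_xzu = comp_bwd_in[OF assms(1,3,4) n]
  note in_xyu = comp_bwd_in[OF assms(1,2,4) n]
  let ?b = "bwd (gtensor_mor ?XY (?YZ \<squnion> ?ZU) ?XY (\<alpha> E Y U) (gid ?XY) (\<beta> E Y Z U))
    (bwd (\<beta> E X Y U) n)"
  have "bwd (\<beta> E X Z U) n \<in> Qs (\<alpha> E X Z \<squnion> ?ZU)"
    using in_xzu by (simp add: gtensor_def mem_Times_iff)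
  then have left: "bwd (gtensor_mor (?XY \<squnion> ?YZ) ?ZU (\<alpha> E X Z) ?ZU (\<beta> E X Y Z) (gid ?ZU))
      (bwd (\<beta> E X Z U) n) = ?L"
    using in_xzu comp_fwd_in[OF assms(1-3)]
    by (auto simp: gtensor_mor_def gtensor_def gid_def case_prod_beta PiE_mem
        intro!: restrict_ext)
  have beta_in: "bwd (\<beta> E X Y U) n \<in> Qs (?XY \<squnion> \<alpha> E Y U)"
    using in_xyu by (simp add: gtensor_def mem_Times_iff)
  then have b: "?b = (\<lambda>p\<in>As ?YZ \<times> As ?ZU. fst (bwd (\<beta> E X Y U) n) (fwd (\<beta> E Y Z U) p),
      \<lambda>f\<in>As ?XY. bwd (\<beta> E Y Z U) (snd (bwd (\<beta> E X Y U) n) f))"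
    using in_xyu comp_fwd_in[OF assms(2-4)]
    by (auto simp: gtensor_mor_def gtensor_def gid_def case_prod_beta PiE_mem
        intro!: restrict_ext)
  have "?b \<in> Qs (?XY \<squnion> (?YZ \<squnion> ?ZU))"
    using gtensor_mor_in_hom[OF gid_in_hom[of ?XY] comp_in_hom[OF assms(2-4)]] beta_in
    by (auto simp: gset_hom_def)
  then have right: "bwd (gassoc ?XY ?YZ ?ZU) ?b = ?R"
    unfolding b by (auto simp: gassoc_def intro!: restrict_ext)
  show ?thesis
    using arg_cong[OF assoc[OF assms(1-4)], of "\<lambda>r. bwd r n"] n left right
    by (simp add: gcomp_def compose_def)
qed

lemma (in PN_category) ract_comp:
  assumes "X \<in> EOb E" "Y \<in> EOb E" "Z \<in> EOb E" "U \<in> EOb E" "n \<in> Qs (\<alpha> E X U)"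
    and "g \<in> As (\<alpha> E Y Z)" "h \<in> As (\<alpha> E Z U)"
  shows "fst (bwd (\<beta> E X Y U) n) (fwd (\<beta> E Y Z U) (g, h)) =
    fst (bwd (\<beta> E X Y Z) (fst (bwd (\<beta> E X Z U) n) h)) g"
  using arg_cong[OF assoc_bwd[OF assms(1-5)], of "\<lambda>p. fst (fst p h) g"] assms(6,7) by simp

lemma (in PN_category) lact_ract:
  assumes "X \<in> EOb E" "Y \<in> EOb E" "Z \<in> EOb E" "U \<in> EOb E" "n \<in> Qs (\<alpha> E X U)"
    and "f \<in> As (\<alpha> E X Y)" "h \<in> As (\<alpha> E Z U)"
  shows "snd (bwd (\<beta> E X Y Z) (fst (bwd (\<beta> E X Z U) n) h)) f =
    fst (bwd (\<beta> E Y Z U) (snd (bwd (\<beta> E X Y U) n) f)) h"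
  using arg_cong[OF assoc_bwd[OF assms(1-5)], of "\<lambda>p. snd (fst p h) f"] assms(6,7) by simp

lemma (in PN_category) lact_comp:
  assumes "X \<in> EOb E" "Y \<in> EOb E" "Z \<in> EOb E" "U \<in> EOb E" "n \<in> Qs (\<alpha> E X U)"
    and "f \<in> As (\<alpha> E X Y)" "g \<in> As (\<alpha> E Y Z)"
  shows "snd (bwd (\<beta> E X Z U) n) (fwd (\<beta> E X Y Z) (f, g)) =
    snd (bwd (\<beta> E Y Z U) (snd (bwd (\<beta> E X Y U) n) f)) g"
  using arg_cong[OF assoc_bwd[OF assms(1-5)], of "\<lambda>p. snd p (f, g)"] assms(6,7) by simp

lemma (in PN_category) ident_fwd:
  assumes "X \<in> EOb E" "Y \<in> EOb E" "f \<in> As (\<alpha> E X Y)"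
  shows "fwd (\<beta> E X X Y) (fwd (\<gamma> E X) (), f) = f"
    and "fwd (\<beta> E X Y Y) (f, fwd (\<gamma> E Y) ()) = f"
  using arg_cong[OF left_unit[OF assms(1,2)], of "\<lambda>r. fwd r ((), f)"]
    arg_cong[OF right_unit[OF assms(1,2)], of "\<lambda>r. fwd r (f, ())"] assms(3)
  by (simp_all add: gcomp_def compose_def gtensor_mor_def glunit_def grunit_def gid_def
      gtensor_def gunit_def)

text \<open>Each unit triangle is evaluated in the component indexed by the point of the unit: this is
  the second component on the left and the first on the right.\<close>

lemma (in PN_category) ident_bwd:
  assumes "X \<in> EOb E" "Y \<in> EOb E" and n: "n \<in> Qs (\<alpha> E X Y)"
  shows "snd (bwd (\<beta> E X X Y) n) (fwd (\<gamma> E X) ()) = n"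
    and "fst (bwd (\<beta> E X Y Y) n) (fwd (\<gamma> E Y) ()) = n"
proof -
  note in_l = comp_bwd_in[OF assms(1,1,2) n]
  note in_r = comp_bwd_in[OF assms(1,2,2) n]
  have "snd (bwd (\<beta> E X X Y) n) (fwd (\<gamma> E X) ()) \<in> Qs (\<alpha> E X Y)"
    using in_l ident_fwd_in[OF assms(1)] by auto
  then show "snd (bwd (\<beta> E X X Y) n) (fwd (\<gamma> E X) ()) = n"
    using arg_cong[OF left_unit[OF assms(1,2)], of "\<lambda>r. snd (bwd r n) ()"] n in_l
    by (simp add: gcomp_def compose_def gtensor_mor_def glunit_def gid_def gtensor_def gunit_def
        case_prod_beta mem_Times_iff)
  have "fst (bwd (\<beta> E X Y Y) n) (fwd (\<gamma> E Y) ()) \<in> Qs (\<alpha> E X Y)"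
    using in_r ident_fwd_in[OF assms(2)] by auto
  then show "fst (bwd (\<beta> E X Y Y) n) (fwd (\<gamma> E Y) ()) = n"
    using arg_cong[OF right_unit[OF assms(1,2)], of "\<lambda>r. fst (bwd r n) ()"] n in_r
    by (simp add: gcomp_def compose_def gtensor_mor_def grunit_def gid_def gtensor_def gunit_def
        case_prod_beta mem_Times_iff)
qed

theorem (in PN_category) nategory_nategory_of: "nategory (nategory_of E)"
proof
  fix X Y Z f n
  assume "X \<in> Ob (nategory_of E)" "Y \<in> Ob (nategory_of E)" "Z \<in> Ob (nategory_of E)"
    "f \<in> Hom (nategory_of E) X Y" "n \<in> Nom (nategory_of E) X Z"
  then show "lact (nategory_of E) X Y Z f n \<in> Nom (nategory_of E) Y Z"
    using comp_bwd_in(2)[of X Y Z n] by (auto simp: nategory_of_def)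
next
  fix X Y Z n g
  assume "X \<in> Ob (nategory_of E)" "Y \<in> Ob (nategory_of E)" "Z \<in> Ob (nategory_of E)"
    "n \<in> Nom (nategory_of E) X Z" "g \<in> Hom (nategory_of E) Y Z"
  then show "ract (nategory_of E) X Y Z n g \<in> Nom (nategory_of E) X Y"
    using comp_bwd_in(1)[of X Y Z n] by (auto simp: nategory_of_def)
qed (simp_all add: nategory_of_def ident_fwd_in comp_fwd_in ident_fwd assoc_fwd comp_incompat)

theorem (in PN_category) identities_neutral_nategory_of: "identities_neutral (nategory_of E)"
  by (simp add: identities_neutral_def nategory_of_def ident_bwd)

theorem (in PN_category) actions_respect_comp_nategory_of: "actions_respect_comp (nategory_of E)"
  by (simp add: actions_respect_comp_def nategory_of_def lact_comp ract_comp)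

theorem (in PN_category) actions_commute_nategory_of: "actions_commute (nategory_of E)"
  by (simp add: actions_commute_def nategory_of_def lact_ract)

section \<open>A nategory that is not enriched\<close>

text \<open>The identities lie in the hom-sets by the category axioms, so neutrality evaluates the actions
  only at arguments where the two collections of data agree.\<close>

lemma identities_neutral_cong:
  assumes "category C" "same_nategory C D" "identities_neutral C"
  shows "identities_neutral D"
  using assms category.ident_in[OF assms(1)]
  unfolding identities_neutral_def same_nategory_def by metis

definition collapsing_nategory :: "(nat, nat, nat) nategory" where
  "collapsing_nategory =
    \<lparr>Ob = {0}, Hom = (\<lambda>_ _. {0}), ident = (\<lambda>_. 0), seq = (\<lambda>_ _ _ _ _. 0),
     Nom = (\<lambda>_ _. {0, 1}), incompat = (\<lambda>_ _ _ _. False),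
     lact = (\<lambda>_ _ _ _ _. 0), ract = (\<lambda>_ _ _ _ _. 0)\<rparr>"

lemma nategory_collapsing: "nategory collapsing_nategory"
  by unfold_locales (simp_all add: collapsing_nategory_def)

lemma not_identities_neutral_collapsing: "\<not> identities_neutral collapsing_nategory"
  by (simp add: identities_neutral_def collapsing_nategory_def)

lemma collapsing_not_enriched:
  assumes "PN_category E"
  shows "\<not> same_nategory (nategory_of E) collapsing_nategory"
proof
  interpret PN_category E by fact
  interpret nategory "nategory_of E" by (rule nategory_nategory_of)
  assume "same_nategory (nategory_of E) collapsing_nategory"
  then have "identities_neutral collapsing_nategory"
    using identities_neutral_cong[OF category_axioms] identities_neutral_nategory_of by blast
  then show False
    using not_identities_neutral_collapsing by contradiction
qed

section \<open>Enriched categories are nategories with additional properties\<close>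

theorem proposition17:
  shows "(\<forall>E :: ('o, 'a, 'q) PN_category. PN_category E \<longrightarrow>
      nategory (nategory_of E) \<and>
      identities_neutral (nategory_of E) \<and>
      actions_respect_comp (nategory_of E) \<and>
      actions_commute (nategory_of E)) \<and>
    (\<exists>C :: (nat, nat, nat) nategory. nategory C \<and>
      \<not> (identities_neutral C \<and> actions_respect_comp C \<and> actions_commute C)) \<and>
    \<not> (\<forall>C :: (nat, nat, nat) nategory. nategory C \<longrightarrow>
      (\<exists>E :: (nat, nat, nat) PN_category. PN_category E \<and> same_nategory (nategory_of E) C))"
  using PN_category.nategory_nategory_of PN_category.identities_neutral_nategory_of
    PN_category.actions_respect_comp_nategory_of PN_category.actions_commute_nategory_of
    nategory_collapsing not_identities_neutral_collapsing collapsing_not_enriched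
  by blast

end
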